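(* Let $S_0>0$ be a non-random initial stock price, $r$ the constant, continuously compounded interest rate, $T>0$ the maturity, $K>0$ the strike price, $H\in(3/4,1]$, $(\sigma,\epsilon)\neq(0,0)$ and $\lambda>0$. Let $(f_\gamma)_{\gamma\ge0}$ be a class of distortion functions and fix $\gamma\ge0$. On a probability space $(\Omega,\mathcal F,P)$ let $(W_t)_{t\ge0}$ be a standard Brownian motion and $(W^H_t)_{t\ge0}$ an independent standard fractional Brownian motion with Hurst index $H$. Let $(N(t))_{t\ge0}$ be a Poisson process with rate $\lambda$, $N(0)=0$, counting the jumps of the stock price, and let $(J_i)_{i\ge1}$ be an i.i.d. sequence of random variables, independent of the jump times, where the stock price is multiplied by $J_i$ at the $i$-th jump. Put $J(t)=\prod_{i=1}^{N(t)}J_i$ (with $J(t)=1$ if $N(t)=0$), and assume that the process $(J(t))_{t\ge0}$ is independent of $(W_t,W^H_t)_{t\ge0}$. Let $$\tilde S(T)=S_0\exp\Big(rT+\sigma W_T+\epsilon W^H_T-\tfrac12\sigma^2T-\tfrac12\epsilon^2T^{2H}\Big),\qquad S_T=\tilde S(T)J(T),$$ and let $F(x)=P(\tilde S(T)J(T)\le x)$. Then the bid price $b_\gamma(C)=e^{-rT}E_{f_\gamma}[C]$ and the ask price $a_\gamma(C)=-e^{-rT}E_{f_\gamma}[-C]$ of the European call option $C=(S_T-K)^+$ are given by $$b_\gamma(C)=e^{-rT}\int_K^\infty (x-K)\,df_\gamma(F(x))=e^{-rT}\int_K^\infty x\,df_\gamma(F(x))-e^{-rT}\int_K^\infty K\,df_\gamma(F(x)),$$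 $$a_\gamma(C)=-e^{-rT}\int_K^\infty (x-K)\,df_\gamma(1-F(x))=-e^{-rT}\int_K^\infty x\,df_\gamma(1-F(x))+e^{-rT}\int_K^\infty K\,df_\gamma(1-F(x)).$$
   Context: A standard fractional Brownian motion with Hurst index $H\in(0,1]$ is an almost surely continuous centered Gaussian process $(W^H_t)$ with $\mathrm{Cov}(W^H_t,W^H_s)=\frac12(|t|^{2H}+|s|^{2H}-|t-s|^{2H})$. A distortion function is a nondecreasing $f:[0,1]\to[0,1]$ with $f(0)=0$ and $f(1)=1$. The distorted expectation of a random variable $X$ with distribution function $F_X$ under $P$ is $$E_f[X]=\int_0^\infty\big(1-f(P(X\le x))\big)\,dx-\int_{-\infty}^0 f(P(X\le x))\,dx=\int_{-\infty}^\infty x\,df(F_X(x)).$$ It is introduced for $X\in L^\infty(\Omega,\mathcal F,P)$, and the same expression is used for the call payoff. The index $\gamma$ of $f_\gamma$ quantifies the degree of distortion (the market liquidity level), and $\gamma=0$ means no distortion. An example of such a class is the WANG-transform $f_\gamma(u)=\Phi(\Phi^{-1}(u)+\gamma)$, with $\Phi$ the standard normal distribution function. For a cash flow $X$ at time $T$, the bid price is $b_\gamma(X)=\sup\{b:E_{f_\gamma}[e^{-rT}X-b]\ge0\}=e^{-rT}E_{f_\gamma}[X]$ and the ask price is $a_\gamma(X)=\inf\{a:E_{f_\gamma}[a-e^{-rT}X]\ge0\}=-e^{-rT}E_{f_\gamma}[-X]$. Integrals $\int h(x)\,dg(x)$ are Stieltjes integrals with respect to the monotone function $g$, which is nonincreasing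 for $g(x)=f_\gamma(1-F(x))$. $y^+=\max(y,0)$.
   Formalization: The integral formulas for the bid (ask) price are proved only if E_{f_γ}[C] (resp. E_{f_γ}[-C]) is finite or f_γ has no jump at 1 (resp. at 0); otherwise they can fail, e.g. f_γ=0 on [0,1) gives bid price ∞ but integral 0. *)

theory Defs
  imports "HOL-Probability.Probability"
begin

section \<open>Stochastic processes on the half-line\<close>

text \<open>Real-valued processes \<open>X t \<omega>\<close> are indexed by \<open>t :: real\<close>; only the times \<open>t \<ge> 0\<close> matter.
  Statements about the law of a whole path use the product \<open>\<sigma>\<close>-algebra on \<open>{0..}\<close>.\<close>

abbreviation path_space :: "(real \<Rightarrow> real) measure" where
  "path_space \<equiv> PiM {0..} (\<lambda>_. borel)"

definition path :: "(real \<Rightarrow> 'a \<Rightarrow> real) \<Rightarrow> 'a \<Rightarrow> real \<Rightarrow> real" where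
  "path X \<omega> = (\<lambda>t\<in>{0..}. X t \<omega>)"

text \<open>\<open>prob_space.indep_var\<close> forces both random elements to have values of the same type; this is
  its characterisation \<open>prob_space.indep_var_eq\<close> without that restriction.\<close>

definition independent_elements ::
  "'a measure \<Rightarrow> 'b measure \<Rightarrow> ('a \<Rightarrow> 'b) \<Rightarrow> 'c measure \<Rightarrow> ('a \<Rightarrow> 'c) \<Rightarrow> bool" where
  "independent_elements M S X T Y \<longleftrightarrow>
     X \<in> measurable M S \<and> Y \<in> measurable M T \<and>
     prob_space.indep_set M
       (sigma_sets (space M) {X -` A \<inter> space M | A. A \<in> sets S})
       (sigma_sets (space M) {Y -` A \<inter> space M | A. A \<in> sets T})"

text \<open>Degenerate normal laws (point masses, \<open>s = 0\<close>) are included.\<close>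

definition gaussian_variable :: "'a measure \<Rightarrow> ('a \<Rightarrow> real) \<Rightarrow> bool" where
  "gaussian_variable M X \<longleftrightarrow> X \<in> borel_measurable M \<and>
     (\<exists>m s. 0 \<le> s \<and>
       distr M borel X = (if s = 0 then return borel m else density lborel (normal_density m s)))"

definition gaussian_process :: "'a measure \<Rightarrow> (real \<Rightarrow> 'a \<Rightarrow> real) \<Rightarrow> bool" where
  "gaussian_process M X \<longleftrightarrow>
     (\<forall>I c. finite I \<and> I \<subseteq> {0..} \<longrightarrow> gaussian_variable M (\<lambda>\<omega>. \<Sum>t\<in>I. c t * X t \<omega>))"

definition covariance :: "'a measure \<Rightarrow> ('a \<Rightarrow> real) \<Rightarrow> ('a \<Rightarrow> real) \<Rightarrow> real" where
  "covariance M X Y =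
     (LINT \<omega>|M. (X \<omega> - (LINT \<omega>|M. X \<omega>)) * (Y \<omega> - (LINT \<omega>|M. Y \<omega>)))"

definition fractional_brownian_motion ::
  "'a measure \<Rightarrow> real \<Rightarrow> (real \<Rightarrow> 'a \<Rightarrow> real) \<Rightarrow> bool" where
  "fractional_brownian_motion M H X \<longleftrightarrow>
     gaussian_process M X \<and>
     (AE \<omega> in M. continuous_on {0..} (\<lambda>t. X t \<omega>)) \<and>
     (\<forall>t\<ge>0. (LINT \<omega>|M. X t \<omega>) = 0) \<and>
     (\<forall>t\<ge>0. \<forall>s\<ge>0. covariance M (X t) (X s) =
        (\<bar>t\<bar> powr (2 * H) + \<bar>s\<bar> powr (2 * H) - \<bar>t - s\<bar> powr (2 * H)) / 2)"

definition independent_increments :: "'a measure \<Rightarrow> (real \<Rightarrow> 'a \<Rightarrow> real) \<Rightarrow> bool" where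
  "independent_increments M X \<longleftrightarrow>
     (\<forall>(n::nat) (t::nat \<Rightarrow> real). 0 \<le> t 0 \<and> mono t \<longrightarrow>
        prob_space.indep_vars M (\<lambda>_. borel) (\<lambda>i \<omega>. X (t (Suc i)) \<omega> - X (t i) \<omega>) {..<n})"

definition standard_brownian_motion :: "'a measure \<Rightarrow> (real \<Rightarrow> 'a \<Rightarrow> real) \<Rightarrow> bool" where
  "standard_brownian_motion M X \<longleftrightarrow>
     (\<forall>t\<ge>0. X t \<in> borel_measurable M) \<and>
     (AE \<omega> in M. X 0 \<omega> = 0) \<and>
     (AE \<omega> in M. continuous_on {0..} (\<lambda>t. X t \<omega>)) \<and>
     independent_increments M X \<and>
     (\<forall>s t. 0 \<le> s \<and> s < t \<longrightarrow>
        distributed M lborel (\<lambda>\<omega>. X t \<omega> - X s \<omega>) (normal_density 0 (sqrt (t - s))))"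

text \<open>In the increment \<open>N t \<omega> - N s \<omega>\<close> the truncating subtraction is harmless, since almost
  every path is nondecreasing.\<close>

definition poisson_process :: "'a measure \<Rightarrow> real \<Rightarrow> (real \<Rightarrow> 'a \<Rightarrow> nat) \<Rightarrow> bool" where
  "poisson_process M rate N \<longleftrightarrow>
     (\<forall>t\<ge>0. N t \<in> measurable M (count_space UNIV)) \<and>
     (AE \<omega> in M. N 0 \<omega> = 0) \<and>
     (AE \<omega> in M. mono_on {0..} (\<lambda>t. N t \<omega>) \<and>
        (\<forall>t\<ge>0. continuous (at_right t) (\<lambda>s. real (N s \<omega>)))) \<and>
     independent_increments M (\<lambda>t \<omega>. real (N t \<omega>)) \<and>
     (\<forall>s t. 0 \<le> s \<and> s < t \<longrightarrow>
        distr M (count_space UNIV) (\<lambda>\<omega>. N t \<omega> - N s \<omega>)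
          = measure_pmf (poisson_pmf (rate * (t - s))))"

text \<open>The time of the \<open>n\<close>-th jump (\<open>n \<ge> 1\<close>), equal to \<open>\<infinity>\<close> if it never occurs.\<close>

definition jump_time :: "(real \<Rightarrow> 'a \<Rightarrow> nat) \<Rightarrow> nat \<Rightarrow> 'a \<Rightarrow> ereal" where
  "jump_time N n \<omega> = (INF t\<in>{t. 0 \<le> t \<and> n \<le> N t \<omega>}. ereal t)"

definition jump_factor ::
  "(real \<Rightarrow> 'a \<Rightarrow> nat) \<Rightarrow> (nat \<Rightarrow> 'a \<Rightarrow> real) \<Rightarrow> real \<Rightarrow> 'a \<Rightarrow> real" where
  "jump_factor N J t \<omega> = (\<Prod>i\<in>{1..N t \<omega>}. J i \<omega>)"

definition iid_sequence :: "'a measure \<Rightarrow> (nat \<Rightarrow> 'a \<Rightarrow> real) \<Rightarrow> bool" where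
  "iid_sequence M J \<longleftrightarrow>
     prob_space.indep_vars M (\<lambda>_. borel) J {1..} \<and>
     (\<forall>i\<ge>1. distr M borel (J i) = distr M borel (J 1))"


section \<open>Distorted expectations and conic prices\<close>

text \<open>The values of a distortion function outside \<open>{0..1}\<close> are irrelevant.\<close>

definition distortion :: "(real \<Rightarrow> real) \<Rightarrow> bool" where
  "distortion f \<longleftrightarrow> mono_on {0..1} f \<and> f \<in> {0..1} \<rightarrow> {0..1} \<and> f 0 = 0 \<and> f 1 = 1"

text \<open>The call payoff is unbounded and no integrability is assumed, so distorted expectations and
  prices take values in the extended reals. The undefined form \<open>\<infinity> - \<infinity>\<close> cannot occur
  for random variables that are bounded from one side.\<close>

definition distorted_expectation ::
  "'a measure \<Rightarrow> (real \<Rightarrow> real) \<Rightarrow> ('a \<Rightarrow> real) \<Rightarrow> ereal" where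
  "distorted_expectation M f X =
     enn2ereal (\<integral>\<^sup>+x\<in>{0..}. ennreal (1 - f (measure M {\<omega> \<in> space M. X \<omega> \<le> x})) \<partial>lborel)
   - enn2ereal (\<integral>\<^sup>+x\<in>{..0}. ennreal (f (measure M {\<omega> \<in> space M. X \<omega> \<le> x})) \<partial>lborel)"

definition bid_price ::
  "'a measure \<Rightarrow> (real \<Rightarrow> real) \<Rightarrow> real \<Rightarrow> real \<Rightarrow> ('a \<Rightarrow> real) \<Rightarrow> ereal" where
  "bid_price M f r T X =
     (SUP b\<in>{b. 0 \<le> distorted_expectation M f (\<lambda>\<omega>. exp (- r * T) * X \<omega> - b)}. ereal b)"

definition ask_price ::
  "'a measure \<Rightarrow> (real \<Rightarrow> real) \<Rightarrow> real \<Rightarrow> real \<Rightarrow> ('a \<Rightarrow> real) \<Rightarrow> ereal" where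
  "ask_price M f r T X =
     (INF a\<in>{a. 0 \<le> distorted_expectation M f (\<lambda>\<omega>. a - exp (- r * T) * X \<omega>)}. ereal a)"


section \<open>Stieltjes integrals with respect to monotone functions\<close>

text \<open>A distortion function need not be continuous, so the integrator need not be right-continuous.
  As usual, the Lebesgue--Stieltjes measure of a nondecreasing \<open>g\<close> is the measure with
  \<open>(a, b] \<mapsto> g (b+) - g (a+)\<close>; \<open>interval_measure\<close> has to be applied to
  the right-continuous version of \<open>g\<close>.\<close>

definition lebesgue_stieltjes :: "(real \<Rightarrow> real) \<Rightarrow> real measure" where
  "lebesgue_stieltjes g = interval_measure (\<lambda>x. Lim (at_right x) g)"

definition stieltjes_integral_incr ::
  "(real \<Rightarrow> real) \<Rightarrow> (real \<Rightarrow> real) \<Rightarrow> real set \<Rightarrow> ereal" where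
  "stieltjes_integral_incr h g A =
     enn2ereal (\<integral>\<^sup>+x\<in>A. ennreal (h x) \<partial>lebesgue_stieltjes g)
   - enn2ereal (\<integral>\<^sup>+x\<in>A. ennreal (- h x) \<partial>lebesgue_stieltjes g)"

text \<open>The integral of \<open>h\<close> over \<open>A\<close> with respect to a monotone (nondecreasing or nonincreasing) \<open>g\<close>.\<close>

definition stieltjes_integral ::
  "(real \<Rightarrow> real) \<Rightarrow> (real \<Rightarrow> real) \<Rightarrow> real set \<Rightarrow> ereal" where
  "stieltjes_integral h g A =
     (if mono g then stieltjes_integral_incr h g A
      else - stieltjes_integral_incr h (\<lambda>x. - g x) A)"

end

(* Writing G for the distorted distribution function, the distorted expectation is the difference of
   the integrals of 1 - G over the positive and of G over the negative half-line. Substitution in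
   these integrals makes it cash-invariant and positively homogeneous, which gives the bid and ask
   prices. For the call, they reduce to integrals of 1 - f (F x), respectively f (1 - F x), over
   x \<ge> K: distribution functions are continuous outside a countable set, so that P (S_T \<ge> x) may be
   replaced by 1 - F x. Tonelli turns the Stieltjes integral of x - K into the integral over x \<ge> K
   of the mass that the Stieltjes measure gives to (x, \<infinity>), which is the same
   integrand as soon as the integrator has the right limit at \<infinity>. *)
theory Submission
  imports Defs
begin

section \<open>Lebesgue--Stieltjes measures of monotone functions\<close>

text \<open>\<open>Lim\<close> is a definite description and says something only once the limit
  exists; by monotonicity it does, as the infimum of \<open>g\<close> on
  \<open>{x<..}\<close>.\<close>

lemma mono_tendsto_right_limit:
  fixes g :: "real \<Rightarrow> real"
  assumes "mono g"
  shows "(g \<longlongrightarrow> Lim (at_right x) g) (at_right x)"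
proof -
  have "(g \<longlongrightarrow> Inf (g ` ({x<..} \<inter> UNIV))) (at x within ({x<..} \<inter> UNIV))"
    by (rule Lim_right_bound[where K = "g x"]) (auto intro: monoD[OF assms])
  then have *: "(g \<longlongrightarrow> Inf (g ` {x<..})) (at_right x)"
    by simp
  then have "Lim (at_right x) g = Inf (g ` {x<..})"
    by (intro tendsto_Lim) auto
  with * show ?thesis by simp
qed

lemma le_right_limit:
  fixes g :: "real \<Rightarrow> real"
  assumes "mono g"
  shows "g x \<le> Lim (at_right x) g"
proof (rule tendsto_lowerbound[OF mono_tendsto_right_limit[OF assms]])
  show "\<forall>\<^sub>F y in at_right x. g x \<le> g y"
    by (auto simp: eventually_at_filter intro!: always_eventually monoD[OF assms])
qed simp

lemma right_limit_le:
  fixes g :: "real \<Rightarrow> real"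
  assumes "mono g" and "x < y"
  shows "Lim (at_right x) g \<le> g y"
proof (rule tendsto_upperbound[OF mono_tendsto_right_limit[OF assms(1)]])
  show "\<forall>\<^sub>F z in at_right x. g z \<le> g y"
    unfolding eventually_at_right_field
    using assms(2) by (auto intro!: exI[of _ y] monoD[OF assms(1)])
qed simp

lemma mono_right_limit:
  fixes g :: "real \<Rightarrow> real"
  assumes "mono g"
  shows "mono (\<lambda>x. Lim (at_right x) g)"
proof (rule monoI)
  fix x y :: real
  assume "x \<le> y"
  then show "Lim (at_right x) g \<le> Lim (at_right y) g"
    using right_limit_le[OF assms, of x y] le_right_limit[OF assms, of y]
    by (cases "x = y") auto
qed

text \<open>Right-continuity and monotonicity are what \<open>interval_measure\<close> asks of its
  distribution function.\<close>

lemma continuous_right_limit: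
  fixes g :: "real \<Rightarrow> real"
  assumes "mono g"
  shows "continuous (at_right x) (\<lambda>x. Lim (at_right x) g)"
  unfolding continuous_within
proof (rule order_tendstoI)
  fix a assume "a < Lim (at_right x) g"
  then show "\<forall>\<^sub>F y in at_right x. a < Lim (at_right y) g"
    by (auto simp: eventually_at_filter intro!: always_eventually
        intro: less_le_trans[OF _ monoD[OF mono_right_limit[OF assms] less_imp_le]])
next
  fix a assume "Lim (at_right x) g < a"
  then have "\<forall>\<^sub>F y in at_right x. g y < a"
    by (rule order_tendstoD[OF mono_tendsto_right_limit[OF assms]])
  then obtain b where b: "b > x" "\<And>y. x < y \<Longrightarrow> y < b \<Longrightarrow> g y < a"
    unfolding eventually_at_right_field by auto
  \<comment> \<open>The midpoint lies strictly to the right of \<open>y\<close> and still below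
    \<open>b\<close>, so the strict bound on \<open>g\<close> there passes to the right limit at
    \<open>y\<close>.\<close>
  have "Lim (at_right y) g < a" if y: "x < y" "y < b" for y
    using right_limit_le[OF assms, of y "(y + b) / 2"] b(2)[of "(y + b) / 2"] y by simp
  then show "\<forall>\<^sub>F y in at_right x. Lim (at_right y) g < a"
    unfolding eventually_at_right_field using b(1) by auto
qed

lemma right_limit_isCont:
  fixes g :: "real \<Rightarrow> real"
  assumes "isCont g x"
  shows "Lim (at_right x) g = g x"
  using assms by (intro tendsto_Lim) (auto simp: isCont_def filterlim_at_split)

text \<open>The discontinuities of a monotone function form a countable set, hence a Lebesgue null
  set.\<close>

lemma AE_isCont_mono:
  fixes g :: "real \<Rightarrow> real"
  assumes "mono g"
  shows "AE x in lborel. isCont g x"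
  using AE_not_in[OF countable_imp_null_set_lborel[OF mono_ctble_discont[OF assms]]] by simp

text \<open>Squeezed between \<open>g x\<close> and \<open>g (x + 1)\<close>.\<close>

lemma right_limit_tendsto_at_top:
  fixes g :: "real \<Rightarrow> real"
  assumes "mono g" and "(g \<longlongrightarrow> L) at_top"
  shows "((\<lambda>x. Lim (at_right x) g) \<longlongrightarrow> L) at_top"
proof (rule tendsto_sandwich[OF _ _ assms(2)])
  show "((\<lambda>x. g (x + 1)) \<longlongrightarrow> L) at_top"
    by (rule filterlim_compose[OF assms(2)])
      (subst add.commute, rule filterlim_tendsto_add_at_top[OF tendsto_const filterlim_ident])
qed (auto intro!: always_eventually le_right_limit right_limit_le assms)

text \<open>The limit is the supremum over the natural numbers; by monotonicity this sequence
  decides the limit along the reals.\<close>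

lemma mono_bounded_tendsto_at_top:
  fixes g :: "real \<Rightarrow> real"
  assumes "mono g" and "\<And>x. g x \<le> B"
  obtains L where "(g \<longlongrightarrow> L) at_top" and "\<And>x. g x \<le> L" and "L \<le> B"
proof -
  have bdd: "bdd_above (range (\<lambda>n. g (real n)))"
    by (rule bdd_aboveI[where M = B]) (auto intro: assms(2))
  have "(\<lambda>n. g (real n)) \<longlonglongrightarrow> (SUP n. g (real n))"
    by (rule LIMSEQ_incseq_SUP[OF bdd]) (auto simp: incseq_def intro!: monoD[OF assms(1)])
  then have L: "(g \<longlongrightarrow> (SUP n. g (real n))) at_top"
    by (intro tendsto_at_topI_sequentially_real assms(1))
  show ?thesis
  proof (rule that[OF L])
    show "g x \<le> (SUP n. g (real n))" for x
      by (rule tendsto_lowerbound[OF L])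
        (auto intro!: eventually_mono[OF eventually_ge_at_top[of x]] monoD[OF assms(1)])
    show "(SUP n. g (real n)) \<le> B"
      by (rule tendsto_upperbound[OF L]) (auto intro: always_eventually assms(2))
  qed
qed

section \<open>Mass and tail integrals of Lebesgue--Stieltjes measures\<close>

lemma sets_lebesgue_stieltjes [simp, measurable_cong]:
  "sets (lebesgue_stieltjes g) = sets borel"
  by (simp add: lebesgue_stieltjes_def)

lemma sigma_finite_lebesgue_stieltjes:
  assumes "mono g"
  shows "sigma_finite_measure (lebesgue_stieltjes g)"
  unfolding lebesgue_stieltjes_def
  by (rule sigma_finite_interval_measure)
    (auto intro: monoD[OF mono_right_limit[OF assms]] continuous_right_limit assms)

text \<open>Continuity from below along the intervals \<open>{a<..a + real n}\<close>, which exhaust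
  the half-line.\<close>

lemma emeasure_lebesgue_stieltjes_Ioi:
  assumes "mono g" and "(g \<longlongrightarrow> L) at_top"
  shows "emeasure (lebesgue_stieltjes g) {a<..} = ennreal (L - Lim (at_right a) g)"
proof -
  let ?G = "\<lambda>x. Lim (at_right x) g"
  let ?M = "lebesgue_stieltjes g"
  have "(\<lambda>n. emeasure ?M {a<..a + real n}) \<longlonglongrightarrow> emeasure ?M (\<Union>n. {a<..a + real n})"
    by (intro Lim_emeasure_incseq) (auto simp: incseq_def)
  also have "(\<Union>n. {a<..a + real n}) = {a<..}"
  proof safe
    fix x assume "a < x"
    then show "x \<in> (\<Union>n. {a<..a + real n})"
      using real_arch_simple[of "x - a"] by (auto simp: algebra_simps)
  qed auto
  finally have 1: "(\<lambda>n. emeasure ?M {a<..a + real n}) \<longlonglongrightarrow> emeasure ?M {a<..}" .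
  have "emeasure ?M {a<..a + real n} = ennreal (?G (a + real n) - ?G a)" for n
    unfolding lebesgue_stieltjes_def
    by (rule emeasure_interval_measure_Ioc)
      (auto intro: monoD[OF mono_right_limit[OF assms(1)]] continuous_right_limit assms)
  moreover have "(\<lambda>n. ennreal (?G (a + real n) - ?G a)) \<longlonglongrightarrow> ennreal (L - ?G a)"
    by (intro tendsto_ennrealI tendsto_diff tendsto_const
        filterlim_compose[OF right_limit_tendsto_at_top[OF assms]]
        filterlim_tendsto_add_at_top[OF tendsto_const] filterlim_real_sequentially)
  ultimately show ?thesis
    using 1 by (auto intro: LIMSEQ_unique)
qed

text \<open>Tonelli on the region \<open>K \<le> t \<and> t < x\<close>: for fixed
  \<open>x > K\<close> the slice has length \<open>x - K\<close>, for fixed \<open>t \<ge> K\<close>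
  it has Stieltjes mass \<open>L - Lim (at_right t) g\<close>.\<close>

lemma nn_integral_lebesgue_stieltjes_tail:
  assumes "mono g" and "(g \<longlongrightarrow> L) at_top"
  shows "(\<integral>\<^sup>+x\<in>{K<..}. ennreal (x - K) \<partial>lebesgue_stieltjes g)
    = (\<integral>\<^sup>+t\<in>{K..}. ennreal (L - g t) \<partial>lborel)"
proof -
  let ?M = "lebesgue_stieltjes g"
  interpret S: sigma_finite_measure ?M
    by (rule sigma_finite_lebesgue_stieltjes[OF assms(1)])
  interpret P: pair_sigma_finite lborel ?M ..
  have sp: "space ?M = UNIV"
    by (simp add: lebesgue_stieltjes_def)
  have "(\<integral>\<^sup>+x\<in>{K<..}. ennreal (x - K) \<partial>?M)
      = (\<integral>\<^sup>+x. (\<integral>\<^sup>+t. indicator {p. K \<le> fst p \<and> fst p < snd p} (t, x) \<partial>lborel) \<partial>?M)"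
  proof (rule nn_integral_cong)
    fix x
    have "(\<integral>\<^sup>+t. indicator {p. K \<le> fst p \<and> fst p < snd p} (t, x) \<partial>lborel)
        = (\<integral>\<^sup>+t. indicator {K..<x} t \<partial>lborel)"
      by (intro nn_integral_cong) (auto simp: indicator_def)
    then show "ennreal (x - K) * indicator {K<..} x
        = (\<integral>\<^sup>+t. indicator {p. K \<le> fst p \<and> fst p < snd p} (t, x) \<partial>lborel)"
      by (cases "K < x") auto
  qed
  also have "\<dots> = (\<integral>\<^sup>+t. (\<integral>\<^sup>+x. indicator {p. K \<le> fst p \<and> fst p < snd p} (t, x) \<partial>?M) \<partial>lborel)"
  proof (rule P.Fubini')
    have "{p \<in> space (borel \<Otimes>\<^sub>M borel :: (real \<times> real) measure). K \<le> fst p \<and> fst p < snd p}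
        \<in> sets (borel \<Otimes>\<^sub>M borel)"
      by measurable
    then have "{p :: real \<times> real. K \<le> fst p \<and> fst p < snd p} \<in> sets (borel \<Otimes>\<^sub>M borel)"
      by (simp add: space_pair_measure)
    then show "(\<lambda>(t, x). indicator {p. K \<le> fst p \<and> fst p < snd p} (t, x))
        \<in> borel_measurable (lborel \<Otimes>\<^sub>M ?M)"
      by (simp cong: measurable_cong_sets sets_pair_measure_cong)
  qed
  also have "\<dots> = (\<integral>\<^sup>+t. ennreal (L - Lim (at_right t) g) * indicator {K..} t \<partial>lborel)"
  proof (rule nn_integral_cong)
    fix t
    have "(\<integral>\<^sup>+x. indicator {p. K \<le> fst p \<and> fst p < snd p} (t, x) \<partial>?M)
        = (\<integral>\<^sup>+x. indicator {K..} t * indicator {t<..} x \<partial>?M)"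
      by (intro nn_integral_cong) (auto simp: indicator_def)
    then show "(\<integral>\<^sup>+x. indicator {p. K \<le> fst p \<and> fst p < snd p} (t, x) \<partial>?M)
        = ennreal (L - Lim (at_right t) g) * indicator {K..} t"
      by (simp add: nn_integral_cmult emeasure_lebesgue_stieltjes_Ioi[OF assms] mult.commute)
  qed
  \<comment> \<open>The right limit differs from \<open>g\<close> only at discontinuities, which
    Lebesgue measure does not see.\<close>
  also have "\<dots> = (\<integral>\<^sup>+t\<in>{K..}. ennreal (L - g t) \<partial>lborel)"
    by (rule nn_integral_cong_AE, rule eventually_mono[OF AE_isCont_mono[OF assms(1)]])
      (simp add: right_limit_isCont)
  finally show ?thesis .
qed

section \<open>Stieltjes integrals over a half-line\<close>

text \<open>\<open>stieltjes_integral\<close> tests \<open>mono g\<close> first, so only a constant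
  \<open>g\<close> falls into the other branch; its Stieltjes measure vanishes on the half-line and
  both sides are 0.\<close>

lemma stieltjes_integral_antimono:
  assumes "antimono g"
  shows "stieltjes_integral h g {K<..} = - stieltjes_integral_incr h (\<lambda>x. - g x) {K<..}"
proof (cases "mono g")
  case True
  then have const: "g = (\<lambda>_. g 0)"
    using assms by (metis antimono_def monoD antisym nle_le)
  have null: "{K<..} \<in> null_sets (lebesgue_stieltjes (\<lambda>_. c))" for c :: real
  proof -
    have "emeasure (lebesgue_stieltjes (\<lambda>_. c)) {K<..} = ennreal (c - Lim (at_right K) (\<lambda>_. c))"
      by (rule emeasure_lebesgue_stieltjes_Ioi) (auto simp: mono_def)
    also have "\<dots> = 0"
      by (subst right_limit_isCont) auto
    finally show ?thesis by auto
  qed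
  have "stieltjes_integral_incr h (\<lambda>_. c) {K<..} = 0" for c :: real
    unfolding stieltjes_integral_incr_def by (simp add: nn_integral_null_set[OF null])
  then show ?thesis
    unfolding stieltjes_integral_def by (subst (1 2 3) const) (auto simp: mono_def)
qed (simp add: stieltjes_integral_def)

text \<open>All three integrands are nonnegative on the half-line, so the subtracted part of
  \<open>stieltjes_integral_incr\<close> vanishes, and splitting \<open>x\<close> into
  \<open>x - K\<close> and \<open>K\<close> is additivity. The third integral, a constant times a
  finite mass, can later be subtracted safely.\<close>

lemma stieltjes_integral_incr_tail:
  assumes "mono g" and "(g \<longlongrightarrow> L) at_top" and "K > 0"
  shows "stieltjes_integral_incr (\<lambda>x. x - K) g {K<..}
      = enn2ereal (\<integral>\<^sup>+t\<in>{K..}. ennreal (L - g t) \<partial>lborel)"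
    and "stieltjes_integral_incr (\<lambda>x. x) g {K<..}
      = stieltjes_integral_incr (\<lambda>x. x - K) g {K<..} + stieltjes_integral_incr (\<lambda>x. K) g {K<..}"
    and "\<bar>stieltjes_integral_incr (\<lambda>x. K) g {K<..}\<bar> \<noteq> \<infinity>"
proof -
  let ?M = "lebesgue_stieltjes g"
  have neg: "(\<integral>\<^sup>+x\<in>{K<..}. ennreal (- h x) \<partial>?M) = 0" if "\<And>x. x > K \<Longrightarrow> 0 \<le> h x" for h
  proof -
    have "(\<integral>\<^sup>+x\<in>{K<..}. ennreal (- h x) \<partial>?M) = (\<integral>\<^sup>+x. 0 \<partial>?M)"
      by (rule nn_integral_cong) (auto simp: indicator_def ennreal_neg that)
    then show ?thesis by simp
  qed
  have incr: "stieltjes_integral_incr h g {K<..} = enn2ereal (\<integral>\<^sup>+x\<in>{K<..}. ennreal (h x) \<partial>?M)"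
    if "\<And>x. x > K \<Longrightarrow> 0 \<le> h x" for h
    unfolding stieltjes_integral_incr_def by (simp add: neg[OF that] zero_ennreal.rep_eq)
  show "stieltjes_integral_incr (\<lambda>x. x - K) g {K<..}
      = enn2ereal (\<integral>\<^sup>+t\<in>{K..}. ennreal (L - g t) \<partial>lborel)"
    by (subst incr) (auto simp: nn_integral_lebesgue_stieltjes_tail[OF assms(1,2)])
  have "(\<integral>\<^sup>+x\<in>{K<..}. ennreal x \<partial>?M)
      = (\<integral>\<^sup>+x. ennreal (x - K) * indicator {K<..} x + ennreal K * indicator {K<..} x \<partial>?M)"
    using \<open>K > 0\<close> by (intro nn_integral_cong) (auto simp: indicator_def simp flip: ennreal_plus)
  also have "\<dots> = (\<integral>\<^sup>+x\<in>{K<..}. ennreal (x - K) \<partial>?M) + (\<integral>\<^sup>+x\<in>{K<..}. ennreal K \<partial>?M)"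
    by (intro nn_integral_add) auto
  finally show "stieltjes_integral_incr (\<lambda>x. x) g {K<..}
      = stieltjes_integral_incr (\<lambda>x. x - K) g {K<..} + stieltjes_integral_incr (\<lambda>x. K) g {K<..}"
    using \<open>K > 0\<close> by (simp add: incr plus_ennreal.rep_eq)
  have "(\<integral>\<^sup>+x\<in>{K<..}. ennreal K \<partial>?M) = ennreal K * ennreal (L - Lim (at_right K) g)"
    by (subst nn_integral_cmult) (auto simp: emeasure_lebesgue_stieltjes_Ioi[OF assms(1,2)])
  also have "\<dots> \<noteq> \<infinity>"
    by (simp add: ennreal_mult_eq_top_iff)
  finally show "\<bar>stieltjes_integral_incr (\<lambda>x. K) g {K<..}\<bar> \<noteq> \<infinity>"
    using \<open>K > 0\<close> by (simp add: incr)
qed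


section \<open>Distorted expectations\<close>

text \<open>The body of \<open>distorted_expectation\<close> with an arbitrary function in place of
  the distorted distribution function, so that substitutions involve no random variable.\<close>

definition tail_difference :: "(real \<Rightarrow> real) \<Rightarrow> ereal" where
  "tail_difference G =
     enn2ereal (\<integral>\<^sup>+x\<in>{0..}. ennreal (1 - G x) \<partial>lborel)
   - enn2ereal (\<integral>\<^sup>+x\<in>{..0}. ennreal (G x) \<partial>lborel)"

text \<open>No finiteness is needed: in the extended reals of the library, \<open>\<infinity> - \<infinity> = \<infinity>\<close>, which is
  invariant under finite shifts.\<close>

lemma tail_difference_shift_nonneg:
  assumes [measurable]: "G \<in> borel_measurable borel"
    and G: "\<And>x. 0 \<le> G x" "\<And>x. G x \<le> 1" and "0 \<le> b"
  shows "tail_difference (\<lambda>x. G (x - b)) = tail_difference G + ereal b"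
proof -
  define P where "P = (\<integral>\<^sup>+x\<in>{0..}. ennreal (1 - G x) \<partial>lborel)"
  define N where "N = (\<integral>\<^sup>+x\<in>{..-b}. ennreal (G x) \<partial>lborel)"
  define A where "A = (\<integral>\<^sup>+x\<in>{-b<..0}. ennreal (1 - G x) \<partial>lborel)"
  define B where "B = (\<integral>\<^sup>+x\<in>{-b<..0}. ennreal (G x) \<partial>lborel)"
  have "(\<integral>\<^sup>+x\<in>{0..}. ennreal (1 - G (x - b)) \<partial>lborel)
      = (\<integral>\<^sup>+x. ennreal (1 - G x) * indicator {0..} (b + x) \<partial>lborel)"
    by (subst nn_integral_real_affine[where c = 1 and t = b]) auto
  \<comment> \<open>\<open>{-b..}\<close> is split into \<open>{-b<..0}\<close> and
    \<open>{0..}\<close>, up to the endpoints \<open>0\<close> and \<open>-b\<close>, which are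
    null.\<close>
  also have "\<dots> = (\<integral>\<^sup>+x. ennreal (1 - G x) * indicator {0..} x
      + ennreal (1 - G x) * indicator {-b<..0} x \<partial>lborel)"
    using AE_lborel_singleton[of 0] AE_lborel_singleton[of "-b"]
    by (intro nn_integral_cong_AE, eventually_elim) (use \<open>0 \<le> b\<close> in \<open>auto simp: indicator_def\<close>)
  also have "\<dots> = P + A"
    unfolding P_def A_def by (rule nn_integral_add) auto
  finally have 1: "(\<integral>\<^sup>+x\<in>{0..}. ennreal (1 - G (x - b)) \<partial>lborel) = P + A" .
  have "(\<integral>\<^sup>+x\<in>{..0}. ennreal (G (x - b)) \<partial>lborel)
      = (\<integral>\<^sup>+x. ennreal (G x) * indicator {..0} (b + x) \<partial>lborel)"
    by (subst nn_integral_real_affine[where c = 1 and t = b]) auto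
  also have "\<dots> = N"
    unfolding N_def by (intro nn_integral_cong) (auto simp: indicator_def)
  finally have 2: "(\<integral>\<^sup>+x\<in>{..0}. ennreal (G (x - b)) \<partial>lborel) = N" .
  have "(\<integral>\<^sup>+x\<in>{..0}. ennreal (G x) \<partial>lborel)
      = (\<integral>\<^sup>+x. ennreal (G x) * indicator {..-b} x + ennreal (G x) * indicator {-b<..0} x \<partial>lborel)"
    using \<open>0 \<le> b\<close> by (intro nn_integral_cong) (auto simp: indicator_def)
  also have "\<dots> = N + B"
    unfolding N_def B_def by (rule nn_integral_add) auto
  finally have 3: "(\<integral>\<^sup>+x\<in>{..0}. ennreal (G x) \<partial>lborel) = N + B" .
  \<comment> \<open>The shift takes \<open>{-b<..0}\<close> out of the negative integral and into
    the positive one. The integrands \<open>G\<close> and \<open>1 - G\<close> add up to 1, so the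
    total gain is the length \<open>b\<close> of the interval.\<close>
  have "A + B = (\<integral>\<^sup>+x. ennreal (1 - G x) * indicator {-b<..0} x
      + ennreal (G x) * indicator {-b<..0} x \<partial>lborel)"
    unfolding A_def B_def by (rule nn_integral_add[symmetric]) auto
  also have "\<dots> = (\<integral>\<^sup>+x. indicator {-b<..0} x \<partial>lborel)"
    by (intro nn_integral_cong) (auto simp: indicator_def G simp flip: ennreal_plus)
  also have "\<dots> = ennreal b"
    using \<open>0 \<le> b\<close> by simp
  finally have AB: "A + B = ennreal b" .
  then have "A < \<infinity>" "B < \<infinity>"
    by (metis ennreal_add_eq_top ennreal_neq_top infinity_ennreal_def top.not_eq_extremum)+
  then obtain a c where a: "A = ennreal a" "0 \<le> a" and c: "B = ennreal c" "0 \<le> c"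
    by (metis ennreal_cases infinity_ennreal_def less_irrefl)
  have b: "b = a + c"
    using AB \<open>0 \<le> b\<close> a c by (simp flip: ennreal_plus)
  \<comment> \<open>\<open>P\<close> and \<open>N\<close> may be infinite, whereas \<open>A\<close>
    and \<open>B\<close> are by now real numbers.\<close>
  show ?thesis
    unfolding tail_difference_def 1 2 3 P_def[symmetric]
    unfolding a(1) c(1) b
    using a(2) c(2)
    by (cases P; cases N) (auto simp: plus_ennreal.rep_eq)
qed

text \<open>A negative shift is undone by a positive one, and the finite summand can be moved across
  the equation.\<close>

lemma tail_difference_shift:
  assumes [measurable]: "G \<in> borel_measurable borel"
    and G: "\<And>x. 0 \<le> G x" "\<And>x. G x \<le> 1"
  shows "tail_difference (\<lambda>x. G (x - b)) = tail_difference G + ereal b"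
proof (cases "0 \<le> b")
  case True
  then show ?thesis
    by (intro tail_difference_shift_nonneg assms)
next
  case False
  have "tail_difference (\<lambda>x. G (x - - b - b)) = tail_difference (\<lambda>x. G (x - b)) + ereal (- b)"
    by (rule tail_difference_shift_nonneg[of "\<lambda>x. G (x - b)"]) (use False G in auto)
  then show ?thesis
    by (cases "tail_difference G"; cases "tail_difference (\<lambda>x. G (x - b))") auto
qed

text \<open>A positive factor is compatible with the convention \<infinity> - \<infinity> =
  \<infinity>; a negative one would turn the left-hand side into -\<infinity> but not the right-hand
  side.\<close>

lemma ereal_mult_diff_distrib:
  fixes x y :: ereal
  assumes "0 < c"
  shows "ereal c * (x - y) = ereal c * x - ereal c * y"
  using assms by (cases x; cases y) (auto simp: algebra_simps)

text \<open>Substituting \<open>c * x\<close> for \<open>x\<close> maps each half-line to itself and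
  contributes the factor \<open>c\<close> to both integrals.\<close>

lemma tail_difference_scale:
  assumes [measurable]: "G \<in> borel_measurable borel" and "0 < c"
  shows "tail_difference (\<lambda>x. G (x / c)) = ereal c * tail_difference G"
proof -
  have "(\<integral>\<^sup>+x\<in>{0..}. ennreal (1 - G (x / c)) \<partial>lborel)
      = ennreal c * (\<integral>\<^sup>+x. ennreal (1 - G x) * indicator {0..} (c * x) \<partial>lborel)"
    using \<open>0 < c\<close> by (subst nn_integral_real_affine[where c = c and t = 0]) auto
  also have "\<dots> = ennreal c * (\<integral>\<^sup>+x\<in>{0..}. ennreal (1 - G x) \<partial>lborel)"
    using \<open>0 < c\<close> by (simp add: indicator_def zero_le_mult_iff)
  finally have 1: "(\<integral>\<^sup>+x\<in>{0..}. ennreal (1 - G (x / c)) \<partial>lborel)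
      = ennreal c * (\<integral>\<^sup>+x\<in>{0..}. ennreal (1 - G x) \<partial>lborel)" .
  have "(\<integral>\<^sup>+x\<in>{..0}. ennreal (G (x / c)) \<partial>lborel)
      = ennreal c * (\<integral>\<^sup>+x. ennreal (G x) * indicator {..0} (c * x) \<partial>lborel)"
    using \<open>0 < c\<close> by (subst nn_integral_real_affine[where c = c and t = 0]) auto
  also have "\<dots> = ennreal c * (\<integral>\<^sup>+x\<in>{..0}. ennreal (G x) \<partial>lborel)"
    using \<open>0 < c\<close> by (simp add: indicator_def mult_le_0_iff)
  finally have 2: "(\<integral>\<^sup>+x\<in>{..0}. ennreal (G (x / c)) \<partial>lborel)
      = ennreal c * (\<integral>\<^sup>+x\<in>{..0}. ennreal (G x) \<partial>lborel)" .
  show ?thesis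
    unfolding tail_difference_def 1 2
    using \<open>0 < c\<close> by (simp add: times_ennreal.rep_eq ereal_mult_diff_distrib)
qed

section \<open>Distorted distribution functions and affine maps\<close>

lemma (in prob_space) mono_distribution_function:
  fixes X :: "'a \<Rightarrow> real"
  assumes [measurable]: "X \<in> borel_measurable M"
  shows "mono (\<lambda>x. measure M {\<omega> \<in> space M. X \<omega> \<le> x})"
proof (intro monoI finite_measure_mono)
  show "{\<omega> \<in> space M. X \<omega> \<le> y} \<in> events" for y
    by measurable
qed auto

text \<open>A distortion may be discontinuous; monotonicity of the composition is what yields its
  Borel measurability.\<close>

lemma (in prob_space) mono_distorted_distribution:
  fixes X :: "'a \<Rightarrow> real"
  assumes "distortion f" and "X \<in> borel_measurable M"
  shows "mono (\<lambda>x. f (measure M {\<omega> \<in> space M. X \<omega> \<le> x}))"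
proof (rule monoI)
  fix x y :: real
  assume "x \<le> y"
  then have "prob {\<omega> \<in> space M. X \<omega> \<le> x} \<le> prob {\<omega> \<in> space M. X \<omega> \<le> y}"
    by (rule monoD[OF mono_distribution_function[OF assms(2)]])
  then show "f (prob {\<omega> \<in> space M. X \<omega> \<le> x}) \<le> f (prob {\<omega> \<in> space M. X \<omega> \<le> y})"
    using assms(1) unfolding distortion_def by (intro mono_onD[of "{0..1}" f]) auto
qed

lemma distortion_bounds:
  assumes "distortion f" and "0 \<le> u" and "u \<le> 1"
  shows "0 \<le> f u" and "f u \<le> 1"
  using assms by (auto simp: distortion_def Pi_iff)

text \<open>Cash invariance and positive homogeneity at once: the event
  \<open>c * X \<omega> + b \<le> x\<close> is \<open>X \<omega> \<le> (x - b) / c\<close>, so the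
  affine map scales and shifts the argument of \<open>G\<close>.\<close>

lemma (in prob_space) distorted_expectation_affine:
  fixes X :: "'a \<Rightarrow> real"
  assumes "distortion f" and "X \<in> borel_measurable M" and "0 < c"
  shows "distorted_expectation M f (\<lambda>\<omega>. c * X \<omega> + b)
    = ereal c * distorted_expectation M f X + ereal b"
proof -
  define G where "G x = f (measure M {\<omega> \<in> space M. X \<omega> \<le> x})" for x
  have [measurable]: "G \<in> borel_measurable borel"
    unfolding G_def by (intro borel_measurable_mono mono_distorted_distribution assms)
  have G01: "0 \<le> G x" "G x \<le> 1" for x
    unfolding G_def by (simp_all add: distortion_bounds[OF assms(1)])
  have iff: "c * y + b \<le> x \<longleftrightarrow> y \<le> (x - b) / c" for x y
    using \<open>0 < c\<close> by (simp add: pos_le_divide_eq algebra_simps)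
  have "distorted_expectation M f (\<lambda>\<omega>. c * X \<omega> + b) = tail_difference (\<lambda>x. G ((x - b) / c))"
    unfolding distorted_expectation_def tail_difference_def G_def iff ..
  also have "\<dots> = tail_difference (\<lambda>x. G (x / c)) + ereal b"
    by (rule tail_difference_shift[of "\<lambda>x. G (x / c)"])
      (simp_all add: G01)
  also have "\<dots> = ereal c * tail_difference G + ereal b"
    using \<open>0 < c\<close> by (simp add: tail_difference_scale)
  also have "tail_difference G = distorted_expectation M f X"
    unfolding distorted_expectation_def tail_difference_def G_def ..
  finally show ?thesis .
qed

section \<open>Bid and ask prices as discounted distorted expectations\<close>

text \<open>The reals are dense in the extended reals. At \<open>e = -\<infinity>\<close> the index
  set is empty, and its supremum is -\<infinity>.\<close>

lemma Sup_ereal_le_eq: "(SUP b\<in>{b. ereal b \<le> e}. ereal b) = e"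
proof (rule antisym)
  show "e \<le> (SUP b\<in>{b. ereal b \<le> e}. ereal b)" (is "_ \<le> ?s")
  proof (rule ccontr)
    assume "\<not> e \<le> ?s"
    then obtain z where z: "?s < ereal z" "ereal z < e"
      using ereal_dense2[of ?s e] by (auto simp: not_le)
    then have "ereal z \<le> ?s"
      by (intro SUP_upper) auto
    with z(1) show False by simp
  qed
qed (auto intro: SUP_least)

lemma Inf_ereal_ge_eq: "(INF a\<in>{a. e \<le> ereal a}. ereal a) = e"
proof (rule antisym)
  show "(INF a\<in>{a. e \<le> ereal a}. ereal a) \<le> e" (is "?s \<le> _")
  proof (rule ccontr)
    assume "\<not> ?s \<le> e"
    then obtain z where z: "e < ereal z" "ereal z < ?s"
      using ereal_dense2[of e ?s] by (auto simp: not_le)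
    then have "?s \<le> ereal z"
      by (intro INF_lower) auto
    with z(2) show False by simp
  qed
qed (auto intro: INF_greatest)

text \<open>By cash invariance \<open>b\<close> is acceptable exactly if it is at most the
  discounted distorted expectation; the supremum of such reals is that value, even if it is
  infinite.\<close>

lemma (in prob_space) bid_price_eq:
  fixes X :: "'a \<Rightarrow> real"
  assumes "distortion f" and "X \<in> borel_measurable M"
  shows "bid_price M f r T X = ereal (exp (- r * T)) * distorted_expectation M f X"
proof -
  let ?e = "ereal (exp (- r * T)) * distorted_expectation M f X"
  have "distorted_expectation M f (\<lambda>\<omega>. exp (- r * T) * X \<omega> - b) = ?e + ereal (- b)" for b
    using distorted_expectation_affine[OF assms, of "exp (- r * T)" "- b"] by simp
  moreover have "0 \<le> ?e + ereal (- b) \<longleftrightarrow> ereal b \<le> ?e" for b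
    by (cases ?e) auto
  ultimately show ?thesis
    unfolding bid_price_def by (simp only: Sup_ereal_le_eq)
qed

lemma (in prob_space) ask_price_eq:
  fixes X :: "'a \<Rightarrow> real"
  assumes "distortion f" and [measurable]: "X \<in> borel_measurable M"
  shows "ask_price M f r T X
    = - ereal (exp (- r * T)) * distorted_expectation M f (\<lambda>\<omega>. - X \<omega>)"
proof -
  let ?e = "ereal (exp (- r * T)) * distorted_expectation M f (\<lambda>\<omega>. - X \<omega>)"
  have "distorted_expectation M f (\<lambda>\<omega>. a - exp (- r * T) * X \<omega>) = ?e + ereal a" for a
    using distorted_expectation_affine[OF assms(1), of "\<lambda>\<omega>. - X \<omega>" "exp (- r * T)" a]
    by (simp add: add.commute)
  moreover have "0 \<le> ?e + ereal a \<longleftrightarrow> - ?e \<le> ereal a" for a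
    by (cases ?e) auto
  ultimately have "ask_price M f r T X = (INF a\<in>{a. - ?e \<le> ereal a}. ereal a)"
    unfolding ask_price_def by simp
  also have "\<dots> = - ?e"
    by (rule Inf_ereal_ge_eq)
  finally show ?thesis
    by (simp flip: uminus_ereal.simps)
qed

section \<open>Call options\<close>

text \<open>The payoff is nonnegative, so the negative half-line contributes nothing; for
  \<open>x \<ge> 0\<close> the payoff is at most \<open>x\<close> exactly if
  \<open>X \<omega> \<le> K + x\<close>, and a shift by \<open>K\<close> finishes.\<close>

lemma (in prob_space) distorted_expectation_call:
  fixes X :: "'a \<Rightarrow> real"
  assumes f: "distortion f" and [measurable]: "X \<in> borel_measurable M"
  shows "distorted_expectation M f (\<lambda>\<omega>. max (X \<omega> - K) 0)
    = enn2ereal (\<integral>\<^sup>+x\<in>{K..}. ennreal (1 - f (prob {\<omega> \<in> space M. X \<omega> \<le> x})) \<partial>lborel)"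
proof -
  define C where "C \<omega> = max (X \<omega> - K) 0" for \<omega>
  have [measurable]: "(\<lambda>x. f (prob {\<omega> \<in> space M. X \<omega> \<le> x})) \<in> borel_measurable borel"
    by (intro borel_measurable_mono mono_distorted_distribution f) measurable
  have "(\<integral>\<^sup>+x\<in>{K..}. ennreal (1 - f (prob {\<omega> \<in> space M. X \<omega> \<le> x})) \<partial>lborel)
      = (\<integral>\<^sup>+x. ennreal (1 - f (prob {\<omega> \<in> space M. X \<omega> \<le> K + x})) * indicator {K..} (K + x) \<partial>lborel)"
    by (subst nn_integral_real_affine[where c = 1 and t = K]) auto
  also have "\<dots> = (\<integral>\<^sup>+x\<in>{0..}. ennreal (1 - f (prob {\<omega> \<in> space M. C \<omega> \<le> x})) \<partial>lborel)"
  proof (rule nn_integral_cong)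
    fix x
    have "{\<omega> \<in> space M. X \<omega> \<le> K + x} = {\<omega> \<in> space M. C \<omega> \<le> x}" if "0 \<le> x"
      using that by (auto simp: C_def)
    then show "ennreal (1 - f (prob {\<omega> \<in> space M. X \<omega> \<le> K + x})) * indicator {K..} (K + x)
        = ennreal (1 - f (prob {\<omega> \<in> space M. C \<omega> \<le> x})) * indicator {0..} x"
      by (simp add: indicator_def)
  qed
  finally have 1: "(\<integral>\<^sup>+x\<in>{0..}. ennreal (1 - f (prob {\<omega> \<in> space M. C \<omega> \<le> x})) \<partial>lborel)
      = (\<integral>\<^sup>+x\<in>{K..}. ennreal (1 - f (prob {\<omega> \<in> space M. X \<omega> \<le> x})) \<partial>lborel)" ..
  have "(\<integral>\<^sup>+x\<in>{..0}. ennreal (f (prob {\<omega> \<in> space M. C \<omega> \<le> x})) \<partial>lborel)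
      = (\<integral>\<^sup>+x. 0 \<partial>(lborel :: real measure))"
  \<comment> \<open>The point 0 is left out: that the payoff is at most 0 means that the option
    expires worthless, which may have positive probability.\<close>
  proof (rule nn_integral_cong_AE, use AE_lborel_singleton[of 0] in eventually_elim)
    fix x :: real
    assume "x \<noteq> 0"
    then have "{\<omega> \<in> space M. C \<omega> \<le> x} = {}" if "x \<le> 0"
      using that by (auto simp: C_def)
    then have "prob {\<omega> \<in> space M. C \<omega> \<le> x} = 0" if "x \<le> 0"
      using that by (metis measure_empty)
    then show "ennreal (f (prob {\<omega> \<in> space M. C \<omega> \<le> x})) * indicator {..0} x = 0"
      using f by (cases "x \<le> 0") (simp_all add: distortion_def)
  qed
  then show ?thesis
    unfolding distorted_expectation_def C_def[symmetric] 1 by (simp add: zero_ennreal.rep_eq)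
qed

lemma cdf_distr:
  assumes "X \<in> borel_measurable M"
  shows "cdf (distr M borel X) = (\<lambda>x. measure M {\<omega> \<in> space M. X \<omega> \<le> x})"
  using assms by (auto simp: cdf_def measure_distr vimage_def Int_def conj_commute intro!: ext)

text \<open>The distribution function jumps exactly at the atoms of \<open>X\<close>; where it is
  continuous, strict and weak inequalities have the same probability.\<close>

lemma (in prob_space) prob_ge_isCont:
  fixes X :: "'a \<Rightarrow> real"
  assumes [measurable]: "X \<in> borel_measurable M"
    and "isCont (\<lambda>x. prob {\<omega> \<in> space M. X \<omega> \<le> x}) x"
  shows "prob {\<omega> \<in> space M. x \<le> X \<omega>} = 1 - prob {\<omega> \<in> space M. X \<omega> \<le> x}"
proof -
  interpret D: real_distribution "distr M borel X"
    by (rule real_distribution_distr) measurable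
  have "measure (distr M borel X) {x} = 0"
    using assms(2) D.isCont_cdf by (simp add: cdf_distr)
  then have atom: "prob {\<omega> \<in> space M. X \<omega> = x} = 0"
    by (simp add: measure_distr vimage_def Int_def conj_commute)
  have "1 - prob {\<omega> \<in> space M. X \<omega> \<le> x} = prob {\<omega> \<in> space M. \<not> X \<omega> \<le> x}"
    by (subst prob_neg) auto
  also have "\<dots> = prob {\<omega> \<in> space M. \<not> X \<omega> \<le> x} + prob {\<omega> \<in> space M. X \<omega> = x}"
    by (simp add: atom)
  also have "\<dots> = prob ({\<omega> \<in> space M. \<not> X \<omega> \<le> x} \<union> {\<omega> \<in> space M. X \<omega> = x})"
    by (intro finite_measure_Union[symmetric]) auto
  also have "{\<omega> \<in> space M. \<not> X \<omega> \<le> x} \<union> {\<omega> \<in> space M. X \<omega> = x} = {\<omega> \<in> space M. x \<le> X \<omega>}"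
    by auto
  finally show ?thesis ..
qed

text \<open>The reflection \<open>K - x\<close> turns \<open>C \<omega> \<le> K - x\<close> into
  \<open>x \<le> X \<omega>\<close> for \<open>x > K\<close>, and for almost every \<open>x\<close>
  the probability of the latter is one minus the distribution function.\<close>

lemma (in prob_space) distorted_expectation_neg_call:
  fixes X :: "'a \<Rightarrow> real"
  assumes f: "distortion f" and [measurable]: "X \<in> borel_measurable M"
  shows "distorted_expectation M f (\<lambda>\<omega>. - max (X \<omega> - K) 0)
    = - enn2ereal (\<integral>\<^sup>+x\<in>{K..}. ennreal (f (1 - prob {\<omega> \<in> space M. X \<omega> \<le> x})) \<partial>lborel)"
proof -
  define C where "C \<omega> = - max (X \<omega> - K) 0" for \<omega>
  have [measurable]: "C \<in> borel_measurable M"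
    unfolding C_def by measurable
  have [measurable]: "(\<lambda>x. f (prob {\<omega> \<in> space M. C \<omega> \<le> x})) \<in> borel_measurable borel"
    by (intro borel_measurable_mono mono_distorted_distribution f) measurable
  have "(\<integral>\<^sup>+x\<in>{..0}. ennreal (f (prob {\<omega> \<in> space M. C \<omega> \<le> x})) \<partial>lborel)
      = (\<integral>\<^sup>+x. ennreal (f (prob {\<omega> \<in> space M. C \<omega> \<le> K - x})) * indicator {..0} (K - x) \<partial>lborel)"
    by (subst nn_integral_real_affine[where c = "-1" and t = K]) auto
  also have "\<dots> = (\<integral>\<^sup>+x\<in>{K..}. ennreal (f (1 - prob {\<omega> \<in> space M. X \<omega> \<le> x})) \<partial>lborel)"
  \<comment> \<open>At \<open>x = K\<close> the reflected event \<open>C \<omega> \<le> 0\<close> is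
    the whole space, whatever \<open>X\<close> is; hence this point is excluded along with the
    discontinuities.\<close>
  proof (rule nn_integral_cong_AE, use AE_lborel_singleton[of K]
      AE_isCont_mono[OF mono_distribution_function[OF assms(2)]] in eventually_elim)
    fix x
    assume x: "x \<noteq> K" "isCont (\<lambda>x. prob {\<omega> \<in> space M. X \<omega> \<le> x}) x"
    have "{\<omega> \<in> space M. C \<omega> \<le> K - x} = {\<omega> \<in> space M. x \<le> X \<omega>}" if "K \<le> x"
      using x(1) that by (auto simp: C_def)
    then show "ennreal (f (prob {\<omega> \<in> space M. C \<omega> \<le> K - x})) * indicator {..0} (K - x)
        = ennreal (f (1 - prob {\<omega> \<in> space M. X \<omega> \<le> x})) * indicator {K..} x"
      by (simp add: indicator_def prob_ge_isCont[OF assms(2) x(2)])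
  qed
  finally have 1: "(\<integral>\<^sup>+x\<in>{..0}. ennreal (f (prob {\<omega> \<in> space M. C \<omega> \<le> x})) \<partial>lborel)
      = (\<integral>\<^sup>+x\<in>{K..}. ennreal (f (1 - prob {\<omega> \<in> space M. X \<omega> \<le> x})) \<partial>lborel)" .
  have "(\<integral>\<^sup>+x\<in>{0..}. ennreal (1 - f (prob {\<omega> \<in> space M. C \<omega> \<le> x})) \<partial>lborel)
      = (\<integral>\<^sup>+x. 0 \<partial>(lborel :: real measure))"
  proof (rule nn_integral_cong)
    fix x :: real
    have "{\<omega> \<in> space M. C \<omega> \<le> x} = space M" if "0 \<le> x"
      using that by (auto simp: C_def)
    then show "ennreal (1 - f (prob {\<omega> \<in> space M. C \<omega> \<le> x})) * indicator {0..} x = 0"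
      using f by (auto simp: indicator_def distortion_def prob_space)
  qed
  then show ?thesis
    unfolding distorted_expectation_def C_def[symmetric] 1 by (simp add: zero_ennreal.rep_eq)
qed

section \<open>From Lebesgue to Stieltjes integrals\<close>

lemma (in prob_space) distribution_function_tendsto_1:
  fixes X :: "'a \<Rightarrow> real"
  assumes [measurable]: "X \<in> borel_measurable M"
  shows "((\<lambda>x. prob {\<omega> \<in> space M. X \<omega> \<le> x}) \<longlongrightarrow> 1) at_top"
proof -
  interpret D: real_distribution "distr M borel X"
    by (rule real_distribution_distr) measurable
  show ?thesis
    using D.cdf_lim_at_top_prob by (simp add: cdf_distr)
qed

text \<open>A Stieltjes integral only sees the increments of its integrator, hence the supremum \<open>L\<close> of \<open>g\<close>
  instead of \<open>B\<close>; if the integral on the right-hand side is finite, then \<open>L = B\<close>.\<close>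

lemma stieltjes_integral_incr_call:
  assumes "mono g" and "\<And>x. g x \<le> B" and "K > 0"
    and "(\<integral>\<^sup>+x\<in>{K..}. ennreal (B - g x) \<partial>lborel) \<noteq> \<infinity> \<or> (g \<longlongrightarrow> B) at_top"
  defines "I \<equiv> enn2ereal (\<integral>\<^sup>+x\<in>{K..}. ennreal (B - g x) \<partial>lborel)"
  shows "stieltjes_integral_incr (\<lambda>x. x - K) g {K<..} = I"
    and "stieltjes_integral_incr (\<lambda>x. x) g {K<..} - stieltjes_integral_incr (\<lambda>x. K) g {K<..} = I"
    and "\<bar>stieltjes_integral_incr (\<lambda>x. K) g {K<..}\<bar> \<noteq> \<infinity>"
proof -
  obtain L where L: "(g \<longlongrightarrow> L) at_top" "\<And>x. g x \<le> L" "L \<le> B"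
    using mono_bounded_tendsto_at_top[OF assms(1,2)] by metis
  have "L = B"
    using assms(4)
  proof
    assume "(g \<longlongrightarrow> B) at_top"
    with L(1) show ?thesis
      by (intro tendsto_unique[of at_top g]) auto
  next
    assume fin: "(\<integral>\<^sup>+x\<in>{K..}. ennreal (B - g x) \<partial>lborel) \<noteq> \<infinity>"
    \<comment> \<open>If \<open>L < B\<close>, the integrand would be at least the positive constant
      \<open>B - L\<close> on a half-line of infinite length, contradicting finiteness.\<close>
    have "ennreal (B - L) * emeasure lborel {K..} = (\<integral>\<^sup>+x\<in>{K..}. ennreal (B - L) \<partial>lborel)"
      by (simp add: nn_integral_cmult)
    also have "\<dots> \<le> (\<integral>\<^sup>+x\<in>{K..}. ennreal (B - g x) \<partial>lborel)"
      by (intro nn_integral_mono mult_right_mono ennreal_leI diff_left_mono L(2)) auto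
    finally have "ennreal (B - L) * emeasure lborel {K..} \<noteq> \<infinity>"
      using fin by (auto simp: top_unique)
    moreover have "emeasure lborel {K..} = \<infinity>"
    proof -
      have "ennreal (real n) \<le> emeasure lborel {K..}" for n
        using emeasure_mono[of "{K..K + real n}" "{K..}" lborel] by simp
      then show ?thesis
        by (metis ennreal_of_nat_eq_real_of_nat ennreal_Ex_less_of_nat infinity_ennreal_def
            linorder_not_le not_less_iff_gr_or_eq top.not_eq_extremum)
    qed
    ultimately show ?thesis
      using L(3) by (auto simp: ennreal_mult_eq_top_iff)
  qed
  note tail = stieltjes_integral_incr_tail[OF assms(1) L(1)[unfolded this] \<open>K > 0\<close>]
  show *: "stieltjes_integral_incr (\<lambda>x. x - K) g {K<..} = I"
    unfolding I_def by (rule tail(1))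
  show "stieltjes_integral_incr (\<lambda>x. x) g {K<..} - stieltjes_integral_incr (\<lambda>x. K) g {K<..} = I"
    \<comment> \<open>Adding and then subtracting the same finite number is harmless even if
      \<open>I\<close> is infinite.\<close>
    unfolding tail(2) * using tail(3)
    by (cases I; cases "stieltjes_integral_incr (\<lambda>x. K) g {K<..}") auto
  show "\<bar>stieltjes_integral_incr (\<lambda>x. K) g {K<..}\<bar> \<noteq> \<infinity>"
    by (rule tail(3))
qed

text \<open>Either condition in \<open>lim\<close> forces \<open>g\<close> to tend to 1. If
  \<open>g\<close> stayed away from 1, then \<open>e\<close> would be infinite, while the Stieltjes
  integral, which does not see this gap, might be finite.\<close>

lemma (in prob_space) distorted_expectation_call_stieltjes:
  fixes X :: "'a \<Rightarrow> real" and f :: "real \<Rightarrow> real" and K :: real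
  assumes f: "distortion f" and X: "X \<in> borel_measurable M" and "K > 0"
  defines "g \<equiv> \<lambda>x. f (prob {\<omega> \<in> space M. X \<omega> \<le> x})"
    and "e \<equiv> distorted_expectation M f (\<lambda>\<omega>. max (X \<omega> - K) 0)"
  assumes lim: "e \<noteq> \<infinity> \<or> (f \<longlongrightarrow> 1) (at_left 1)"
  shows "stieltjes_integral (\<lambda>x. x - K) g {K<..} = e"
    and "stieltjes_integral (\<lambda>x. x) g {K<..} - stieltjes_integral (\<lambda>x. K) g {K<..} = e"
proof -
  have e: "e = enn2ereal (\<integral>\<^sup>+x\<in>{K..}. ennreal (1 - g x) \<partial>lborel)"
    unfolding e_def g_def by (rule distorted_expectation_call[OF f X])
  have mono: "mono g"
    unfolding g_def by (rule mono_distorted_distribution[OF f X])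
  have le1: "g x \<le> 1" for x
    unfolding g_def by (simp add: distortion_bounds[OF f])
  have "(g \<longlongrightarrow> 1) at_top" if "(f \<longlongrightarrow> 1) (at_left 1)"
  proof (rule order_tendstoI)
    fix a :: real
    assume "a < 1"
    then have "\<forall>\<^sub>F u in at_left 1. a < f u"
      by (rule order_tendstoD[OF that])
    then obtain b where b: "b < 1" "\<And>u. b < u \<Longrightarrow> u < 1 \<Longrightarrow> a < f u"
      unfolding eventually_at_left_field by auto
    have "\<forall>\<^sub>F x in at_top. b < prob {\<omega> \<in> space M. X \<omega> \<le> x}"
      by (rule order_tendstoD(1)[OF distribution_function_tendsto_1[OF X] b(1)])
    then show "\<forall>\<^sub>F x in at_top. a < g x"
    proof eventually_elim
      case (elim x)
      \<comment> \<open>The distribution function may attain 1, where the left limit of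
        \<open>f\<close> is silent; \<open>f 1 = 1\<close> covers this case.\<close>
      have "a < f u" if "b < u" "u \<le> 1" for u
        using that b(2)[of u] \<open>a < 1\<close> f by (cases "u = 1") (auto simp: distortion_def)
      with elim show ?case
        unfolding g_def by simp
    qed
  next
    fix a :: real
    assume "1 < a"
    then show "\<forall>\<^sub>F x in at_top. g x < a"
      by (intro always_eventually allI le_less_trans[OF le1])
  qed
  then have "(\<integral>\<^sup>+x\<in>{K..}. ennreal (1 - g x) \<partial>lborel) \<noteq> \<infinity> \<or> (g \<longlongrightarrow> 1) at_top"
    using lim unfolding e by auto
  note int = stieltjes_integral_incr_call[OF mono le1 \<open>K > 0\<close> this, folded e]
  show "stieltjes_integral (\<lambda>x. x - K) g {K<..} = e"
    and "stieltjes_integral (\<lambda>x. x) g {K<..} - stieltjes_integral (\<lambda>x. K) g {K<..} = e"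
    using int mono by (simp_all add: stieltjes_integral_def)
qed

text \<open>The argument for the call itself, now with the nondecreasing integrator
  \<open>- g\<close> and the upper bound 0. Finiteness of the constant integral is recorded for
  distributing a negative discount factor over the difference.\<close>

lemma (in prob_space) distorted_expectation_neg_call_stieltjes:
  fixes X :: "'a \<Rightarrow> real" and f :: "real \<Rightarrow> real" and K :: real
  assumes f: "distortion f" and X: "X \<in> borel_measurable M" and "K > 0"
  defines "g \<equiv> \<lambda>x. f (1 - prob {\<omega> \<in> space M. X \<omega> \<le> x})"
    and "e \<equiv> distorted_expectation M f (\<lambda>\<omega>. - max (X \<omega> - K) 0)"
  assumes lim: "e \<noteq> -\<infinity> \<or> (f \<longlongrightarrow> 0) (at_right 0)"
  shows "stieltjes_integral (\<lambda>x. x - K) g {K<..} = e"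
    and "stieltjes_integral (\<lambda>x. x) g {K<..} - stieltjes_integral (\<lambda>x. K) g {K<..} = e"
    and "\<bar>stieltjes_integral (\<lambda>x. K) g {K<..}\<bar> \<noteq> \<infinity>"
proof -
  \<comment> \<open>The form \<open>0 - - g x\<close> matches \<open>B - g x\<close> for the bound 0
    and the integrator \<open>- g\<close>.\<close>
  have e: "e = - enn2ereal (\<integral>\<^sup>+x\<in>{K..}. ennreal (0 - - g x) \<partial>lborel)"
    unfolding e_def g_def by (simp add: distorted_expectation_neg_call[OF f X])
  have anti: "antimono g"
  proof (rule antimonoI)
    fix x y :: real
    assume "x \<le> y"
    then have "prob {\<omega> \<in> space M. X \<omega> \<le> x} \<le> prob {\<omega> \<in> space M. X \<omega> \<le> y}"
      by (rule monoD[OF mono_distribution_function[OF X]])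
    then show "g y \<le> g x"
      using f unfolding g_def distortion_def by (intro mono_onD[of "{0..1}" f]) auto
  qed
  then have mono: "mono (\<lambda>x. - g x)"
    by (auto simp: mono_def antimono_def)
  have ge0: "0 \<le> g x" for x
    unfolding g_def by (simp add: distortion_bounds[OF f])
  have "(g \<longlongrightarrow> 0) at_top" if "(f \<longlongrightarrow> 0) (at_right 0)"
  proof (rule order_tendstoI)
    fix a :: real
    assume "0 < a"
    then have "\<forall>\<^sub>F u in at_right 0. f u < a"
      by (rule order_tendstoD[OF that])
    then obtain b where b: "0 < b" "\<And>u. 0 < u \<Longrightarrow> u < b \<Longrightarrow> f u < a"
      unfolding eventually_at_right_field by auto
    have "\<forall>\<^sub>F x in at_top. 1 - b < prob {\<omega> \<in> space M. X \<omega> \<le> x}"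
      using b(1) by (intro order_tendstoD[OF distribution_function_tendsto_1[OF X]]) simp
    then show "\<forall>\<^sub>F x in at_top. g x < a"
    proof eventually_elim
      case (elim x)
      \<comment> \<open>The case \<open>u = 0\<close> occurs where the distribution function attains
        1; there \<open>f 0 = 0\<close> replaces the right limit.\<close>
      have "f u < a" if "0 \<le> u" "u < b" for u
        using that b(2)[of u] \<open>0 < a\<close> f by (cases "u = 0") (auto simp: distortion_def)
      with elim show ?case
        unfolding g_def by simp
    qed
  next
    fix a :: real
    assume "a < 0"
    then show "\<forall>\<^sub>F x in at_top. a < g x"
      by (intro always_eventually allI less_le_trans[OF _ ge0])
  qed
  then have "(f \<longlongrightarrow> 0) (at_right 0) \<Longrightarrow> ((\<lambda>x. - g x) \<longlongrightarrow> 0) at_top"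
    using tendsto_minus[of g 0 at_top] by simp
  then have "(\<integral>\<^sup>+x\<in>{K..}. ennreal (0 - - g x) \<partial>lborel) \<noteq> \<infinity> \<or> ((\<lambda>x. - g x) \<longlongrightarrow> 0) at_top"
    using lim unfolding e by auto
  note int = stieltjes_integral_incr_call[OF mono _ \<open>K > 0\<close> this]
  have int1: "stieltjes_integral_incr (\<lambda>x. x - K) (\<lambda>x. - g x) {K<..} = - e"
    and int2: "stieltjes_integral_incr (\<lambda>x. x) (\<lambda>x. - g x) {K<..}
      - stieltjes_integral_incr (\<lambda>x. K) (\<lambda>x. - g x) {K<..} = - e"
    and fin: "\<bar>stieltjes_integral_incr (\<lambda>x. K) (\<lambda>x. - g x) {K<..}\<bar> \<noteq> \<infinity>"
    using int by (simp_all add: e ge0)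
  note neg = stieltjes_integral_antimono[OF anti]
  show "stieltjes_integral (\<lambda>x. x - K) g {K<..} = e"
    by (simp add: neg int1)
  show "stieltjes_integral (\<lambda>x. x) g {K<..} - stieltjes_integral (\<lambda>x. K) g {K<..} = e"
    unfolding neg
    using int2 fin
    by (cases "stieltjes_integral_incr (\<lambda>x. x) (\<lambda>x. - g x) {K<..}";
        cases "stieltjes_integral_incr (\<lambda>x. K) (\<lambda>x. - g x) {K<..}"; cases e) auto
  show "\<bar>stieltjes_integral (\<lambda>x. K) g {K<..}\<bar> \<noteq> \<infinity>"
    unfolding neg using fin by simp
qed

section \<open>Application to the stock price model\<close>

text \<open>Evaluation at a time \<open>t \<ge> 0\<close> is a coordinate projection of the path
  space, composed here with the measurable path map.\<close>

lemma independent_elements_path_measurable: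
  assumes "independent_elements M path_space (path X) S Y" and "0 \<le> t"
  shows "X t \<in> borel_measurable M"
proof -
  have "path X \<in> measurable M path_space"
    using assms(1) by (simp add: independent_elements_def)
  then have "(\<lambda>\<omega>. path X \<omega> t) \<in> borel_measurable M"
    using measurable_component_singleton[of t "{0..}" "\<lambda>_. borel"] assms(2)
    by (auto intro: measurable_compose)
  then show ?thesis
    using assms(2) by (simp add: path_def)
qed

text \<open>The two implications guard against a distortion that jumps at 1 or at 0: mass lost at
  infinity enters the distorted expectation but not a Stieltjes integral.\<close>

theorem mainTheorem1:
  fixes M :: "'a measure"
    and S0 r T K H \<sigma> \<epsilon> rate \<gamma> :: real
    and f :: "real \<Rightarrow> real \<Rightarrow> real"
    and W WH :: "real \<Rightarrow> 'a \<Rightarrow> real"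
    and N :: "real \<Rightarrow> 'a \<Rightarrow> nat"
    and J :: "nat \<Rightarrow> 'a \<Rightarrow> real"
    and S_tilde S_T C :: "'a \<Rightarrow> real"
    and F :: "real \<Rightarrow> real"
  assumes "prob_space M"
    and "S0 > 0" and "T > 0" and "K > 0" and "3 / 4 < H" and "H \<le> 1"
    and "(\<sigma>, \<epsilon>) \<noteq> (0, 0)" and "rate > 0"
    and "\<forall>\<gamma>\<ge>0. distortion (f \<gamma>)" and "\<gamma> \<ge> 0"
    and "standard_brownian_motion M W"
    and "fractional_brownian_motion M H WH"
    and "independent_elements M path_space (path W) path_space (path WH)"
    and "poisson_process M rate N"
    and "iid_sequence M J"
    and "independent_elements M
           (PiM {1..} (\<lambda>_. borel)) (\<lambda>\<omega>. \<lambda>i\<in>{1..}. J i \<omega>)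
           (PiM {1..} (\<lambda>_. borel)) (\<lambda>\<omega>. \<lambda>n\<in>{1..}. jump_time N n \<omega>)"
    and "independent_elements M
           path_space (path (jump_factor N J))
           (path_space \<Otimes>\<^sub>M path_space) (\<lambda>\<omega>. (path W \<omega>, path WH \<omega>))"
    and "S_tilde = (\<lambda>\<omega>. S0 * exp (r * T + \<sigma> * W T \<omega> + \<epsilon> * WH T \<omega>
                                  - \<sigma>\<^sup>2 * T / 2 - \<epsilon>\<^sup>2 * T powr (2 * H) / 2))"
    and "S_T = (\<lambda>\<omega>. S_tilde \<omega> * jump_factor N J T \<omega>)"
    and "F = (\<lambda>x. measure M {\<omega> \<in> space M. S_tilde \<omega> * jump_factor N J T \<omega> \<le> x})"
    and "C = (\<lambda>\<omega>. max (S_T \<omega> - K) 0)"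
  shows
    "bid_price M (f \<gamma>) r T C = ereal (exp (- r * T)) * distorted_expectation M (f \<gamma>) C
     \<and> ask_price M (f \<gamma>) r T C
         = - ereal (exp (- r * T)) * distorted_expectation M (f \<gamma>) (\<lambda>\<omega>. - C \<omega>)
     \<and> (distorted_expectation M (f \<gamma>) C \<noteq> \<infinity> \<or> (f \<gamma> \<longlongrightarrow> 1) (at_left 1) \<longrightarrow>
          bid_price M (f \<gamma>) r T C
            = ereal (exp (- r * T)) * stieltjes_integral (\<lambda>x. x - K) (\<lambda>x. f \<gamma> (F x)) {K<..}
        \<and> bid_price M (f \<gamma>) r T C
            = ereal (exp (- r * T)) * stieltjes_integral (\<lambda>x. x) (\<lambda>x. f \<gamma> (F x)) {K<..}
            - ereal (exp (- r * T)) * stieltjes_integral (\<lambda>x. K) (\<lambda>x. f \<gamma> (F x)) {K<..})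
     \<and> (distorted_expectation M (f \<gamma>) (\<lambda>\<omega>. - C \<omega>) \<noteq> -\<infinity> \<or> (f \<gamma> \<longlongrightarrow> 0) (at_right 0) \<longrightarrow>
          ask_price M (f \<gamma>) r T C
            = - ereal (exp (- r * T)) * stieltjes_integral (\<lambda>x. x - K) (\<lambda>x. f \<gamma> (1 - F x)) {K<..}
        \<and> ask_price M (f \<gamma>) r T C
            = - ereal (exp (- r * T)) * stieltjes_integral (\<lambda>x. x) (\<lambda>x. f \<gamma> (1 - F x)) {K<..}
            + ereal (exp (- r * T)) * stieltjes_integral (\<lambda>x. K) (\<lambda>x. f \<gamma> (1 - F x)) {K<..})"
proof -
  interpret prob_space M
    by (rule assms(1))
  have f: "distortion (f \<gamma>)"
    using assms(9,10) by blast
  have [measurable]: "W T \<in> borel_measurable M"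
    by (rule independent_elements_path_measurable[OF assms(13)]) (use assms(3) in simp)
  \<comment> \<open>A single value of a Gaussian process is a linear combination with one term and
    coefficient 1.\<close>
  have "gaussian_variable M (\<lambda>\<omega>. \<Sum>t\<in>{T}. 1 * WH t \<omega>)"
    using assms(12) \<open>T > 0\<close> unfolding fractional_brownian_motion_def gaussian_process_def
    by (elim conjE allE[of _ "{T}"] allE[of _ "\<lambda>_. 1"]) auto
  then have [measurable]: "WH T \<in> borel_measurable M"
    by (simp add: gaussian_variable_def)
  have [measurable]: "jump_factor N J T \<in> borel_measurable M"
    by (rule independent_elements_path_measurable[OF assms(17)]) (use assms(3) in simp)
  have X[measurable]: "S_T \<in> borel_measurable M"
    unfolding assms(18,19) by measurable
  have C: "C = (\<lambda>\<omega>. max (S_T \<omega> - K) 0)"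
    by (rule assms(21))
  have [measurable]: "C \<in> borel_measurable M"
    unfolding C by measurable
  have F: "F = (\<lambda>x. prob {\<omega> \<in> space M. S_T \<omega> \<le> x})"
    unfolding assms(19,20) ..
  let ?c = "exp (- r * T)"
  let ?e = "distorted_expectation M (f \<gamma>) C"
  let ?e' = "distorted_expectation M (f \<gamma>) (\<lambda>\<omega>. - C \<omega>)"
  have bid: "bid_price M (f \<gamma>) r T C = ereal ?c * ?e"
    by (rule bid_price_eq[OF f]) measurable
  have ask: "ask_price M (f \<gamma>) r T C = - ereal ?c * ?e'"
    by (rule ask_price_eq[OF f]) measurable
  have bid_integral: "ereal ?c * ?e
        = ereal ?c * stieltjes_integral (\<lambda>x. x - K) (\<lambda>x. f \<gamma> (F x)) {K<..}
      \<and> ereal ?c * ?e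
        = ereal ?c * stieltjes_integral (\<lambda>x. x) (\<lambda>x. f \<gamma> (F x)) {K<..}
        - ereal ?c * stieltjes_integral (\<lambda>x. K) (\<lambda>x. f \<gamma> (F x)) {K<..}"
    if "?e \<noteq> \<infinity> \<or> (f \<gamma> \<longlongrightarrow> 1) (at_left 1)"
  proof -
    note call = distorted_expectation_call_stieltjes
      [OF f X \<open>K > 0\<close>, folded C F, OF that]
    show ?thesis
      unfolding F using call by (simp flip: ereal_mult_diff_distrib)
  qed
  have ask_integral: "- ereal ?c * ?e'
        = - ereal ?c * stieltjes_integral (\<lambda>x. x - K) (\<lambda>x. f \<gamma> (1 - F x)) {K<..}
      \<and> - ereal ?c * ?e'
        = - ereal ?c * stieltjes_integral (\<lambda>x. x) (\<lambda>x. f \<gamma> (1 - F x)) {K<..}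
        + ereal ?c * stieltjes_integral (\<lambda>x. K) (\<lambda>x. f \<gamma> (1 - F x)) {K<..}"
    if "?e' \<noteq> -\<infinity> \<or> (f \<gamma> \<longlongrightarrow> 0) (at_right 0)"
  proof -
    have lim: "distorted_expectation M (f \<gamma>) (\<lambda>\<omega>. - max (S_T \<omega> - K) 0) \<noteq> -\<infinity>
        \<or> (f \<gamma> \<longlongrightarrow> 0) (at_right 0)"
      using that unfolding C .
    note call = distorted_expectation_neg_call_stieltjes[OF f X \<open>K > 0\<close> lim]
    define A where "A = stieltjes_integral (\<lambda>x. x) (\<lambda>x. f \<gamma> (1 - F x)) {K<..}"
    define B where "B = stieltjes_integral (\<lambda>x. K) (\<lambda>x. f \<gamma> (1 - F x)) {K<..}"
    have "stieltjes_integral (\<lambda>x. x - K) (\<lambda>x. f \<gamma> (1 - F x)) {K<..} = ?e'"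
      and AB: "?e' = A - B" and "\<bar>B\<bar> \<noteq> \<infinity>"
      unfolding A_def B_def C F using call by simp_all
    \<comment> \<open>The factor is negative and \<open>A\<close> may be infinite; since
      \<open>B\<close> is finite, \<infinity> - \<infinity> cannot arise and the product
      distributes.\<close>
    moreover have "- ereal ?c * (A - B) = - ereal ?c * A + ereal ?c * B"
      using \<open>\<bar>B\<bar> \<noteq> \<infinity>\<close> by (cases A; cases B) (auto simp: algebra_simps)
    ultimately show ?thesis
      unfolding A_def[symmetric] B_def[symmetric] by simp
  qed
  show ?thesis
    unfolding bid ask using bid_integral ask_integral by blast
qed

end
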